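(* Let $c \in \mathbb{C}$ be arbitrary, let $P(t) = \sum_{j=0}^{d} \pi_j t^j$ be a polynomial with complex coefficients and $\pi_d \neq 0$, and let $u(x)$ be a solution of the ordinary differential equation $$u''u - (u')^2 = e^{-x}P(u) - 1$$ admitting a formal series of the form $$u(x) = \sum_{k=0}^{\infty} p_k(x+c)e^{-kx},$$ where the $p_k$ are polynomials with complex coefficients and $p_0(x) = x$. Then $\pi_0 = 0$ and $\pi_1 = \pi_2$. In particular, $d \geq 2$. Moreover, the coefficients of the polynomials $p_k$ do not depend on $c$ (i.e., for given $P$, if formal series of this form with constants $c, \tilde c \in \mathbb{C}$ and polynomials $p_k$, respectively $\tilde p_k$, with $p_0(x)=\tilde p_0(x)=x$, both satisfy the equation, then $p_k = \tilde p_k$ for all $k$).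
   Context: That a solution admits a formal series $\sum_{k\ge 0} p_k(x+c)e^{-kx}$ is understood formally: the series, substituted into the differential equation (with termwise differentiation, and with products and powers expanded as Cauchy products), satisfies it identically as a formal series in $e^{-x}$ with coefficients polynomial in $x$. That is, for every integer $s \ge 0$ the polynomial coefficients of $e^{-sx}$ on both sides coincide. No convergence of the series is assumed. By convention $\pi_j = 0$ for $j > d$. *)

theory Defs
  imports "HOL-Computational_Algebra.Computational_Algebra"
begin

text \<open>
  Formal series in \<open>e\<^sup>-\<^sup>x\<close> with coefficients polynomial in \<open>x\<close> are elements of
  \<^typ>\<open>complex poly fps\<close>: the coefficient at \<open>k\<close> is the polynomial in \<open>x\<close> multiplying
  \<open>e\<^sup>-\<^sup>k\<^sup>x\<close>, and the indeterminate \<^const>\<open>fps_X\<close> stands for \<open>e\<^sup>-\<^sup>x\<close>.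
  Multiplication of power series is then the Cauchy product.
\<close>

type_synonym exp_series = "complex poly fps"

text \<open>The series \<open>\<Sum>k. p\<^sub>k(x + c) e\<^sup>-\<^sup>k\<^sup>x\<close>.\<close>

definition shifted_series :: "complex \<Rightarrow> (nat \<Rightarrow> complex poly) \<Rightarrow> exp_series" where
  "shifted_series c p = Abs_fps (\<lambda>k. pcompose (p k) [:c, 1:])"

text \<open>
  Termwise derivative with respect to \<open>x\<close>, where
  \<open>(q(x) e\<^sup>-\<^sup>k\<^sup>x)' = (q'(x) - k q(x)) e\<^sup>-\<^sup>k\<^sup>x\<close>. This is not \<^const>\<open>fps_deriv\<close>, which
  differentiates with respect to the indeterminate.
\<close>

definition x_deriv :: "exp_series \<Rightarrow> exp_series" where
  "x_deriv u = Abs_fps (\<lambda>k. pderiv (fps_nth u k) - of_nat k * fps_nth u k)"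

definition poly_subst :: "complex poly \<Rightarrow> exp_series \<Rightarrow> exp_series" where
  "poly_subst P u = (\<Sum>j\<le>degree P. fps_const [:coeff P j:] * u ^ j)"

text \<open>\<open>u'' u - (u')\<^sup>2 = e\<^sup>-\<^sup>x P(u) - 1\<close>, coefficientwise.\<close>

definition formally_solves :: "complex poly \<Rightarrow> exp_series \<Rightarrow> bool" where
  "formally_solves P u \<longleftrightarrow>
     x_deriv (x_deriv u) * u - (x_deriv u)\<^sup>2 = fps_X * poly_subst P u - 1"

end

theory Submission imports Defs begin

text \<open>
  Write \<open>t\<close> for \<^const>\<open>fps_X\<close>, that is for \<open>e\<^sup>-\<^sup>x\<close>, and \<open>D\<close> for \<^const>\<open>x_deriv\<close>. The ring of
  exponential series is an integral domain, and \<open>D\<close> is a derivation of it with \<open>D t = - t\<close> that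
  kills the complex constants. Replacing \<open>x\<close> by \<open>x + c\<close> in all coefficients is a
  ring homomorphism that commutes with \<open>D\<close> and fixes \<open>t\<close> and the constants. It therefore preserves
  the equation, and \<open>c = 0\<close> may be assumed throughout (\<open>formally_solves_unshifted\<close>).

  \<^emph>\<open>Conditions on the coefficients of P.\<close> The idea is a Painleve test at a zero of the solution:
  the equation degenerates where \<open>u = 0\<close>, and its Taylor coefficients there satisfy a constraint.
  Algebraically, a zero of \<open>u\<close> is the quotient of the ring by the ideal generated by \<open>u\<close>. Only
  \<open>\<pi>\<^sub>0, \<pi>\<^sub>1, \<pi>\<^sub>2\<close> survive in this quotient when the equation is differentiated at most twice. With
  \<open>w = D u\<close> and \<open>v = D w\<close>, the equation and its first two derivatives become
    \<^item> \<open>w\<^sup>2 \<equiv> 1 - \<pi>\<^sub>0 t\<close>,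
    \<^item> \<open>v w \<equiv> t (\<pi>\<^sub>0 - \<pi>\<^sub>1 w)\<close>,
    \<^item> \<open>- v\<^sup>2 \<equiv> t (\<pi>\<^sub>0 - 2 \<pi>\<^sub>1 w + \<pi>\<^sub>1 v + 2 \<pi>\<^sub>2 w\<^sup>2)\<close>.

  Multiplying the third by \<open>w\<^sup>2\<close>, eliminating \<open>v\<close> and cancelling \<open>t\<close> leaves a quartic relation
  \<open>\<pi>\<^sub>0 - \<pi>\<^sub>1 w - \<pi>\<^sub>1 w\<^sup>3 + 2 \<pi>\<^sub>2 w\<^sup>4 \<equiv> 0\<close> for the slope at the zero (\<open>slope_relations\<close>). Its
  product with the conjugate under \<open>w \<mapsto> - w\<close> is a polynomial \<open>M\<close> in \<open>w\<^sup>2\<close> with constant term \<open>\<pi>\<^sub>0\<^sup>2\<close>,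
  so \<open>M(1 - \<pi>\<^sub>0 t) \<equiv> 0\<close>. But no nonzero polynomial in \<open>t\<close> vanishes modulo \<open>u\<close>
  (\<open>scalar_poly_not_multiple\<close>), so \<open>M(1 - \<pi>\<^sub>0 t)\<close> is zero as a polynomial; if \<open>\<pi>\<^sub>0\<close> were nonzero, its value
  at \<open>t = 1 / \<pi>\<^sub>0\<close> would give \<open>\<pi>\<^sub>0\<^sup>2 = 0\<close>. Hence \<open>\<pi>\<^sub>0 = 0\<close>, and \<open>w = 1\<close> at \<open>t = 0\<close> turns the quartic
  relation into \<open>- 2 \<pi>\<^sub>1 + 2 \<pi>\<^sub>2 = 0\<close>.

  \<^emph>\<open>Uniqueness.\<close> At the lowest order \<open>n > 0\<close> at which two solutions could differ, the coefficient \<open>q\<close> of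
  their difference satisfies the homogeneous linear equation \<open>x L(L q) = 2 L q\<close> with \<open>L f = f' - n f\<close>. Since \<open>L\<close>
  preserves degrees, the left side has larger degree than the right side unless \<open>q = 0\<close>.
\<close>

section \<open>The differential ring of exponential series\<close>

abbreviation scalar :: "complex \<Rightarrow> exp_series" where
  "scalar a \<equiv> fps_const [:a:]"

lemma x_deriv_nth: "fps_nth (x_deriv u) k = pderiv (fps_nth u k) - of_nat k * fps_nth u k"
  by (simp add: x_deriv_def)

lemma x_deriv_add: "x_deriv (u + v) = x_deriv u + x_deriv v"
  by (rule fps_ext) (simp add: x_deriv_nth pderiv_add algebra_simps)

lemma x_deriv_diff: "x_deriv (u - v) = x_deriv u - x_deriv v"
  by (rule fps_ext) (simp add: x_deriv_nth pderiv_diff algebra_simps)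

lemma x_deriv_mult: "x_deriv (u * v) = x_deriv u * v + u * x_deriv v"
proof (rule fps_ext)
  fix n
  have summand: "pderiv (fps_nth u i * fps_nth v (n - i)) - of_nat n * (fps_nth u i * fps_nth v (n - i))
      = fps_nth (x_deriv u) i * fps_nth v (n - i) + fps_nth u i * fps_nth (x_deriv v) (n - i)"
    if "i \<in> {0..n}" for i
  proof -
    have "(of_nat n :: complex poly) = of_nat i + of_nat (n - i)"
      using that by (simp flip: of_nat_add)
    then show ?thesis
      by (simp add: x_deriv_nth pderiv_mult algebra_simps)
  qed
  have "fps_nth (x_deriv (u * v)) n =
      (\<Sum>i=0..n. pderiv (fps_nth u i * fps_nth v (n - i)) - of_nat n * (fps_nth u i * fps_nth v (n - i)))"
    by (simp add: x_deriv_nth fps_mult_nth sum_subtractf sum_distrib_left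
        higher_pderiv_sum[of 1, simplified])
  then show "fps_nth (x_deriv (u * v)) n = fps_nth (x_deriv u * v + u * x_deriv v) n"
    using summand by (simp add: fps_mult_nth sum.distrib)
qed

lemma x_deriv_scalar: "x_deriv (scalar a) = 0"
  by (rule fps_ext) (simp add: x_deriv_nth pderiv_pCons)

lemma x_deriv_one: "x_deriv 1 = 0"
  by (rule fps_ext) (simp add: x_deriv_nth)

lemma x_deriv_numeral: "x_deriv (numeral k) = 0"
  by (rule fps_ext) (simp add: x_deriv_nth fps_numeral_nth numeral_poly pderiv_pCons)

lemma x_deriv_fps_X: "x_deriv fps_X = - fps_X"
  by (rule fps_ext) (auto simp: x_deriv_nth fps_X_def)

lemma poly_subst_altdef: "poly_subst P u = poly (map_poly scalar P) u"
proof -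
  have "degree (map_poly scalar P) = degree P"
    by (rule degree_map_poly) auto
  then show ?thesis
    by (simp add: poly_subst_def poly_altdef coeff_map_poly)
qed

lemma poly_subst_pCons: "poly_subst (pCons a P) u = scalar a + u * poly_subst P u"
  by (simp add: poly_subst_altdef map_poly_pCons)

lemma poly_subst_0: "poly_subst 0 u = 0"
  by (simp add: poly_subst_altdef)

lemma poly_subst_one: "poly_subst 1 u = 1"
  by (simp add: one_pCons poly_subst_pCons poly_subst_0 flip: fps_const_1_eq_1)

lemma poly_subst_add: "poly_subst (P + Q) u = poly_subst P u + poly_subst Q u"
  by (induction P Q rule: poly_induct2)
    (simp_all add: poly_subst_0 poly_subst_pCons algebra_simps flip: fps_const_add)

lemma poly_subst_diff: "poly_subst (P - Q) u = poly_subst P u - poly_subst Q u"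
  using poly_subst_add[of "P - Q" Q u] by (simp add: algebra_simps)

lemma poly_subst_smult: "poly_subst (smult a P) u = scalar a * poly_subst P u"
  by (induction P) (simp_all add: poly_subst_0 poly_subst_pCons algebra_simps)

lemma poly_subst_mult: "poly_subst (P * Q) u = poly_subst P u * poly_subst Q u"
  by (induction P)
    (simp_all add: poly_subst_0 poly_subst_pCons poly_subst_add poly_subst_smult algebra_simps)

lemma poly_subst_pcompose: "poly_subst (pcompose P Q) u = poly_subst P (poly_subst Q u)"
  by (induction P)
    (simp_all add: poly_subst_0 poly_subst_pCons poly_subst_add poly_subst_mult pcompose_pCons)

section \<open>Translation of the variable\<close>

definition translate :: "complex \<Rightarrow> exp_series \<Rightarrow> exp_series" where
  "translate c u = Abs_fps (\<lambda>k. pcompose (fps_nth u k) [:c, 1:])"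

lemma translate_nth: "fps_nth (translate c u) k = pcompose (fps_nth u k) [:c, 1:]"
  by (simp add: translate_def)

lemma translate_add: "translate c (u + v) = translate c u + translate c v"
  by (rule fps_ext) (simp add: translate_nth pcompose_add)

lemma translate_diff: "translate c (u - v) = translate c u - translate c v"
  by (rule fps_ext) (simp add: translate_nth pcompose_diff)

lemma translate_mult: "translate c (u * v) = translate c u * translate c v"
  by (rule fps_ext) (simp add: translate_nth fps_mult_nth pcompose_sum pcompose_mult)

lemma translate_scalar: "translate c (scalar a) = scalar a"
  by (rule fps_ext) (simp add: translate_nth)

lemma translate_one: "translate c 1 = 1"
  by (rule fps_ext) (simp add: translate_nth pcompose_1)

lemma translate_fps_X: "translate c fps_X = fps_X"
  by (rule fps_ext) (simp add: translate_nth fps_X_def pcompose_1)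

lemma translate_x_deriv: "translate c (x_deriv u) = x_deriv (translate c u)"
  by (rule fps_ext)
    (simp add: translate_nth x_deriv_nth pcompose_diff pcompose_mult pderiv_pcompose pderiv_pCons
      of_nat_poly pcompose_smult)

lemma translate_poly_subst: "translate c (poly_subst P u) = poly_subst P (translate c u)"
proof (induction P)
  case 0
  show ?case
    by (rule fps_ext) (simp add: poly_subst_def translate_nth)
next
  case (pCons a P)
  then show ?case
    by (simp add: poly_subst_pCons translate_add translate_mult translate_scalar)
qed

lemma formally_solves_translate:
  assumes "formally_solves P u"
  shows "formally_solves P (translate c u)"
  using arg_cong[OF assms[unfolded formally_solves_def], of "translate c"]
  by (simp add: formally_solves_def translate_diff translate_mult translate_x_deriv
      translate_poly_subst translate_one translate_fps_X power2_eq_square)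

text \<open>
  No factor \<open>e\<^sup>c\<close> appears on the right-hand side, because the translation acts on the polynomial
  coefficients only and leaves the formal symbol for \<open>e\<^sup>-\<^sup>x\<close> alone.
\<close>

lemma formally_solves_unshifted:
  assumes "formally_solves P (shifted_series c p)"
  shows "formally_solves P (Abs_fps p)"
proof -
  have "pcompose [:c, 1:] [:- c, 1:] = [:0, 1:]"
    by (simp add: pcompose_pCons)
  then have "translate (- c) (shifted_series c p) = Abs_fps p"
    by (intro fps_ext) (simp add: translate_nth shifted_series_def flip: pcompose_assoc)
  then show ?thesis
    using formally_solves_translate[OF assms, of "- c"] by simp
qed

section \<open>Uniqueness\<close>

lemma degree_pderiv_diff_smult:
  fixes r :: "'a::{idom, semiring_char_0} poly"
  assumes "s \<noteq> 0"
  shows "degree (pderiv r - smult s r) = degree r"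
proof (cases "degree r = 0")
  case True
  then obtain a where "r = [:a:]"
    by (rule degree_eq_zeroE)
  then show ?thesis
    by (simp add: pderiv_pCons)
next
  case False
  then have "degree (pderiv r) < degree (smult s r)"
    using assms by (simp add: degree_pderiv)
  then show ?thesis
    using assms degree_add_eq_right[of "pderiv r" "- smult s r"] by simp
qed

text \<open>
  With \<open>L f = f' - s f\<close> the hypothesis is \<open>x L(L q) = 2 L q\<close>, the linearisation at the leading term
  \<open>u = x\<close>. If \<open>L q\<close> were nonzero, the left side would have degree one more than the right side.
\<close>

lemma linearised_kernel_trivial:
  fixes q :: "'a::{idom, semiring_char_0} poly"
  assumes "s \<noteq> 0"
    and "r = pderiv q - smult s q"
    and eq: "[:0, 1:] * (pderiv r - smult s r) = 2 * r"
  shows "q = 0"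
proof -
  have inj: "f = 0" if "pderiv f - smult s f = 0" for f :: "'a poly"
  proof -
    have "degree f = 0"
      using degree_pderiv_diff_smult[OF \<open>s \<noteq> 0\<close>, of f] that by simp
    then obtain a where "f = [:a:]"
      by (rule degree_eq_zeroE)
    then show ?thesis
      using that \<open>s \<noteq> 0\<close> by (simp add: pderiv_pCons)
  qed
  have "r = 0"
  proof (rule ccontr)
    assume "r \<noteq> 0"
    then have "pderiv r - smult s r \<noteq> 0"
      using inj by blast
    then have "degree ([:0, 1:] * (pderiv r - smult s r)) = Suc (degree r)"
      using degree_pderiv_diff_smult[OF \<open>s \<noteq> 0\<close>, of r] by simp
    moreover have "degree (2 * r) \<le> degree r"
      using degree_smult_le[of 2 r] by (simp add: numeral_poly)
    ultimately show False
      using eq by (metis Suc_n_not_le_n)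
  qed
  then show ?thesis
    using inj assms(2) by simp
qed

lemma fps_mult_nth_lowest:
  fixes f g :: "'a::comm_ring_1 fps"
  assumes "\<And>i. i < n \<Longrightarrow> fps_nth f i = 0"
  shows "fps_nth (f * g) n = fps_nth f n * fps_nth g 0"
proof -
  have "fps_nth (f * g) n = (\<Sum>i\<in>{n}. fps_nth f i * fps_nth g (n - i))"
    unfolding fps_mult_nth by (rule sum.mono_neutral_right) (auto simp: assms)
  then show ?thesis by simp
qed

lemma diff_dvd_poly_subst_diff: "u - v dvd poly_subst P u - poly_subst P v"
proof (induction P)
  case 0
  show ?case by (simp add: poly_subst_def)
next
  case (pCons a P)
  have "poly_subst (pCons a P) u - poly_subst (pCons a P) v
      = (u - v) * poly_subst P u + v * (poly_subst P u - poly_subst P v)"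
    by (simp add: poly_subst_pCons algebra_simps)
  then show ?case
    using pCons.IH by simp
qed

text \<open>
  Subtracting the two equations gives \<open>d u'' + d'' v - d' (u' + v') = t d G\<close> for the difference
  \<open>d = u - v\<close>, which has \<open>d\<close> or one of its derivatives in every product. When all terms of \<open>d\<close> below
  order \<open>n\<close> vanish, its coefficient at \<open>n\<close> therefore involves only the leading terms of the other
  factors, and these are known.
\<close>

lemma formal_solution_unique:
  assumes u: "formally_solves P u" "fps_nth u 0 = [:0, 1:]"
    and v: "formally_solves P v" "fps_nth v 0 = [:0, 1:]"
  shows "u = v"
proof -
  define d where "d = u - v"
  have "fps_nth d n = 0" for n
  proof (induction n rule: less_induct)
    case (less n)
    show ?case
    proof (cases "n = 0")
      case True
      then show ?thesis using u v by (simp add: d_def)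
    next
      case False
      let ?q = "fps_nth d n" and ?D = x_deriv
      define r where "r = pderiv ?q - smult (of_nat n) ?q"
      have top: "fps_nth (?D d) n = r" "fps_nth (?D (?D d)) n = pderiv r - smult (of_nat n) r"
        by (simp_all add: r_def x_deriv_nth of_nat_poly)
      have bottom: "fps_nth (?D (?D u)) 0 = 0" "fps_nth (?D u + ?D v) 0 = 2"
        using u(2) v(2) by (simp_all add: x_deriv_nth pderiv_pCons flip: one_pCons)
      have low: "fps_nth d i = 0" "fps_nth (?D d) i = 0" "fps_nth (?D (?D d)) i = 0"
        if "i < n" for i
        using less that by (simp_all add: x_deriv_nth)
      obtain G where G: "poly_subst P u - poly_subst P v = d * G"
        using diff_dvd_poly_subst_diff unfolding d_def by (metis dvdE)
      have "d * ?D (?D u) + ?D (?D d) * v - ?D d * (?D u + ?D v)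
          = (?D (?D u) * u - (?D u)\<^sup>2) - (?D (?D v) * v - (?D v)\<^sup>2)"
        by (simp add: d_def x_deriv_diff algebra_simps power2_eq_square)
      also have "\<dots> = fps_X * (poly_subst P u - poly_subst P v)"
        using u(1) v(1) by (simp add: formally_solves_def right_diff_distrib)
      also have "\<dots> = d * (G * fps_X)"
        unfolding G by (simp only: ac_simps)
      finally have "d * ?D (?D u) + ?D (?D d) * v - ?D d * (?D u + ?D v) = d * (G * fps_X)" .
      from arg_cong[OF this, of "\<lambda>f. fps_nth f n"]
      have "?q * fps_nth (?D (?D u)) 0 + fps_nth (?D (?D d)) n * fps_nth v 0
          - fps_nth (?D d) n * fps_nth (?D u + ?D v) 0 = ?q * fps_nth (G * fps_X) 0"
        by (simp only: fps_add_nth fps_sub_nth fps_mult_nth_lowest low)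
      then have "[:0, 1:] * (pderiv r - smult (of_nat n) r) = 2 * r"
        by (simp only: top bottom v(2) ac_simps fps_mult_nth_0 fps_X_nth mult_zero_right
            right_minus_eq add_0_left if_False) simp
      with False r_def show ?thesis
        using linearised_kernel_trivial[of "of_nat n" r ?q] by simp
    qed
  qed
  then show ?thesis
    by (simp add: d_def fps_eq_iff)
qed

section \<open>Reduction modulo the solution\<close>

lemma dvd_nth_0:
  fixes f g :: "'a::comm_ring_1 fps"
  assumes "f dvd g"
  shows "fps_nth f 0 dvd fps_nth g 0"
  using assms by auto

text \<open>
  In other words, \<open>t\<close> is not a zero divisor modulo \<open>u\<close>: in \<open>t f = u g\<close> the lowest coefficient of \<open>g\<close>
  must vanish, so \<open>g\<close> is itself a multiple of \<open>t\<close>.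
\<close>

lemma dvd_fps_X_mult_cancel:
  fixes u f :: "'a::idom fps"
  assumes "fps_nth u 0 \<noteq> 0" and "u dvd fps_X * f"
  shows "u dvd f"
proof -
  obtain g where g: "fps_X * f = u * g"
    using assms(2) by (rule dvdE)
  from arg_cong[OF g, of "\<lambda>h. fps_nth h 0"] have "fps_nth g 0 = 0"
    using assms(1) by simp
  then have "g = fps_X * fps_shift 1 g"
    by (intro fps_ext) auto
  then have "u * g = u * (fps_X * fps_shift 1 g)"
    by (rule arg_cong)
  then have "fps_X * f = fps_X * (u * fps_shift 1 g)"
    unfolding g by (simp only: mult.left_commute)
  then show ?thesis by simp
qed

lemma monom_dvd_const: "[:0, 1:] dvd [:a:] \<longleftrightarrow> a = (0::complex)"
  using poly_eq_0_iff_dvd[of "[:a:]" 0] by simp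

text \<open>
  The powers of \<open>t\<close> remain linearly independent over the complex numbers modulo \<open>u\<close>. At order zero
  \<open>u\<close> is \<open>x\<close>, which divides no nonzero constant, so the constant term of \<open>N\<close> vanishes; then a factor
  \<open>t\<close> can be cancelled and the argument repeated.
\<close>

lemma scalar_poly_not_multiple:
  assumes u0: "fps_nth u 0 = [:0, 1:]" and "u dvd poly_subst N fps_X"
  shows "N = 0"
  using assms(2)
proof (induction N)
  case (pCons a N)
  then have dvd: "u dvd scalar a + fps_X * poly_subst N fps_X"
    by (simp add: poly_subst_pCons)
  from dvd_nth_0[OF this] have "a = 0"
    by (simp add: u0 monom_dvd_const)
  with dvd have "u dvd fps_X * poly_subst N fps_X"
    by simp
  then have "u dvd poly_subst N fps_X"
    by (rule dvd_fps_X_mult_cancel[rotated]) (simp add: u0)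
  with pCons.IH \<open>a = 0\<close> show ?case by simp
qed simp

text \<open>
  The constraint on the slope \<open>w\<close> at a zero of \<open>u\<close>. The first relation is the equation itself modulo
  \<open>u\<close>. For the second, the equation is differentiated twice: the first derivative expresses \<open>v w\<close> in
  terms of \<open>w\<close>, where \<open>v\<close> is the second derivative of \<open>u\<close>, and the second derivative of the
  equation is the compatibility condition, since in it the fourth derivative of \<open>u\<close> is multiplied by
  \<open>u\<close> and the two terms with the third derivative cancel.
\<close>

lemma slope_relations:
  assumes sol: "formally_solves P u" and u0: "fps_nth u 0 = [:0, 1:]"
  defines "w \<equiv> x_deriv u"
  shows "u dvd w ^ 2 - (1 - fps_X * scalar (coeff P 0))"
    and "u dvd scalar (coeff P 0) - scalar (coeff P 1) * w - scalar (coeff P 1) * w ^ 3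
      + 2 * scalar (coeff P 2) * w ^ 4"
proof -
  define a b c where "a = scalar (coeff P 0)" and "b = scalar (coeff P 1)"
    and "c = scalar (coeff P 2)"
  define v where "v = x_deriv w"
  define A where "A = poly_subst P u"
  \<comment> \<open>Terms of degree three and more in \<open>u\<close> stay divisible by \<open>u\<close> after two derivatives.\<close>
  obtain S where A: "A = a + b * u + c * u * u + u * u * u * S"
  proof -
    obtain a' b' c' Q where "P = pCons a' (pCons b' (pCons c' Q))"
      by (metis pCons_cases)
    then show ?thesis
      using that[of "poly_subst Q u"]
      by (simp add: A_def a_def b_def c_def poly_subst_pCons algebra_simps numeral_2_eq_2)
  qed
  note leibniz = x_deriv_add x_deriv_diff x_deriv_mult x_deriv_scalar x_deriv_one x_deriv_numeral
    x_deriv_fps_X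
  have const: "x_deriv a = 0" "x_deriv b = 0" "x_deriv c = 0"
    by (simp_all add: a_def b_def c_def x_deriv_scalar)
  obtain T0 where T0: "A = a + u * T0"
    using that[of "b + c * u + u * u * S"] A by (simp add: algebra_simps)
  obtain T1 where T1: "x_deriv A = b * w + u * T1"
    using that[of "2 * c * w + 3 * w * u * S + u * u * x_deriv S"]
    by (simp add: A leibniz const w_def algebra_simps)
  obtain T2 where T2: "x_deriv (x_deriv A) = b * v + 2 * c * w ^ 2 + u * T2"
    using that[of "2 * c * v + 6 * w * w * S + 3 * v * u * S + 6 * w * u * x_deriv S
        + u * u * x_deriv (x_deriv S)"]
    by (simp add: A leibniz const w_def v_def algebra_simps power2_eq_square)
  have e0: "v * u - w * w = fps_X * A - 1"
    using sol by (simp add: formally_solves_def A_def v_def w_def power2_eq_square)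
  from arg_cong[OF e0, of x_deriv]
  have e1: "x_deriv v * u - v * w = fps_X * x_deriv A - fps_X * A"
    by (simp add: leibniz algebra_simps flip: v_def w_def)
  from arg_cong[OF e1, of x_deriv]
  have e2: "x_deriv (x_deriv v) * u - v * v
      = fps_X * A - 2 * fps_X * x_deriv A + fps_X * x_deriv (x_deriv A)"
    by (simp add: leibniz algebra_simps flip: v_def w_def)
  obtain R0 where R0: "w * w = 1 - fps_X * a + u * R0"
    using e0 T0 that[of "v - fps_X * T0"] by (simp add: algebra_simps)
  obtain R1 where R1: "v * w = fps_X * (a - b * w) + u * R1"
    using e1 T0 T1 that[of "x_deriv v + fps_X * T0 - fps_X * T1"] by (simp add: algebra_simps)
  obtain R2 where R2: "v * v + fps_X * (a - 2 * b * w + b * v + 2 * c * w ^ 2) = u * R2"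
    using e2 T0 T1 T2 that[of "x_deriv (x_deriv v) - fps_X * T0 + 2 * fps_X * T1 - fps_X * T2"]
    by (simp add: algebra_simps)
  show "u dvd w ^ 2 - (1 - fps_X * scalar (coeff P 0))"
    using R0 by (simp add: a_def power2_eq_square)
  \<comment> \<open>The cofactor that results from eliminating \<open>v\<close> with explicit multiples of \<open>u\<close>: the third
    relation is multiplied by \<open>w\<^sup>2\<close>, then the second replaces \<open>v w\<close> and the first \<open>w\<^sup>2\<close>.\<close>
  define K where "K = w ^ 2 * R2 - R1 * (v * w + fps_X * (a - b * w)) - fps_X * b * w * R1
    - fps_X * R0 * (a - b * w)"
  have "fps_X * (a - b * w - b * w ^ 3 + 2 * c * w ^ 4) - u * K
      = w ^ 2 * (v * v + fps_X * (a - 2 * b * w + b * v + 2 * c * w ^ 2) - u * R2)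
        - (v * w + fps_X * a) * (v * w - (fps_X * (a - b * w) + u * R1))
        - fps_X * (a - b * w) * (w * w - (1 - fps_X * a + u * R0))"
    unfolding K_def by algebra
  also have "\<dots> = 0"
    using R0 R1 R2 by simp
  finally have "fps_X * (a - b * w - b * w ^ 3 + 2 * c * w ^ 4) = u * K"
    by simp
  then have "u dvd fps_X * (a - b * w - b * w ^ 3 + 2 * c * w ^ 4)"
    by simp
  then show "u dvd scalar (coeff P 0) - scalar (coeff P 1) * w - scalar (coeff P 1) * w ^ 3
      + 2 * scalar (coeff P 2) * w ^ 4"
    unfolding a_def b_def c_def by (rule dvd_fps_X_mult_cancel[rotated]) (simp add: u0)
qed

lemma low_coefficients:
  assumes sol: "formally_solves P u" and u0: "fps_nth u 0 = [:0, 1:]"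
  shows "coeff P 0 = 0" and "coeff P 1 = coeff P 2"
proof -
  define \<alpha> \<beta> \<gamma> where "\<alpha> = coeff P 0" and "\<beta> = coeff P 1" and "\<gamma> = coeff P 2"
  define a b c where "a = scalar \<alpha>" and "b = scalar \<beta>" and "c = scalar \<gamma>"
  note abc = \<alpha>_def \<beta>_def \<gamma>_def a_def b_def c_def
  define w where "w = x_deriv u"
  define y where "y = 1 - fps_X * a"
  have sq: "u dvd w ^ 2 - y" and quartic: "u dvd a - b * w - b * w ^ 3 + 2 * c * w ^ 4"
    using slope_relations[OF sol u0] by (simp_all add: abc w_def y_def)
  have "fps_nth w 0 = 1"
    by (simp add: w_def x_deriv_nth u0 pderiv_pCons one_pCons)
  with dvd_nth_0[OF quartic] have "[:0, 1:] dvd [:\<alpha> - 2 * \<beta> + 2 * \<gamma>:]"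
    by (simp add: a_def b_def c_def u0 fps_numeral_nth numeral_poly fps_power_zeroth algebra_simps)
  then have sum0: "\<alpha> - 2 * \<beta> + 2 * \<gamma> = 0"
    by (simp only: monom_dvd_const)
  \<comment> \<open>The norm of the quartic over the polynomials in \<open>y\<close>, where \<open>w\<^sup>2 \<equiv> y\<close>: multiplying the quartic
    by its conjugate under \<open>w \<mapsto> - w\<close> leaves a polynomial \<open>M\<close> in \<open>w\<^sup>2\<close> alone.\<close>
  define T where "T = [:0, 1 :: complex:]"
  define M where "M = ([:\<alpha>:] + [:2 * \<gamma>:] * T ^ 2) ^ 2 - [:\<beta>:] ^ 2 * T * (1 + T) ^ 2"
  have two_c: "scalar (2 * \<gamma>) = 2 * c"
    by (simp add: c_def numeral_fps_const numeral_poly)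
  have M: "poly_subst M z = (a + 2 * c * z ^ 2) ^ 2 - b ^ 2 * z * (1 + z) ^ 2" for z
    by (simp only: M_def T_def poly_subst_add poly_subst_diff poly_subst_mult poly_subst_pCons
        poly_subst_0 poly_subst_one power2_eq_square two_c a_def b_def mult_zero_right add_0_right
        fps_const_0_eq_0 pCons_0_0 add_0_left mult_1_right one_pCons[symmetric] fps_const_1_eq_1)
  have "poly_subst M (w ^ 2)
      = (a - b * w - b * w ^ 3 + 2 * c * w ^ 4) * (a + b * w + b * w ^ 3 + 2 * c * w ^ 4)"
    unfolding M by algebra
  then have "u dvd poly_subst M (w ^ 2)"
    using quartic by simp
  moreover have "u dvd poly_subst M (w ^ 2) - poly_subst M y"
    using sq diff_dvd_poly_subst_diff by (rule dvd_trans)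
  ultimately have "u dvd poly_subst M y"
    by (metis dvd_diff diff_diff_eq2 add_diff_cancel_left')
  moreover have "y = poly_subst [:1, - \<alpha>:] fps_X"
    by (simp add: y_def a_def poly_subst_pCons poly_subst_0 flip: one_pCons fps_const_neg)
  ultimately have "pcompose M [:1, - \<alpha>:] = 0"
    using scalar_poly_not_multiple[OF u0] by (simp add: poly_subst_pcompose)
  then have M0: "poly M (poly [:1, - \<alpha>:] (1 / \<alpha>)) = 0"
    by (metis poly_0 poly_pcompose)
  have \<alpha>: "\<alpha> = 0"
  proof (rule ccontr)
    assume "\<alpha> \<noteq> 0"
    \<comment> \<open>Then \<open>1 / \<alpha>\<close> is the zero of \<open>1 - \<alpha> t\<close>, and the value of \<open>M\<close> at \<open>0\<close> is \<open>\<alpha>\<^sup>2\<close>.\<close>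
    with M0 show False
      by (simp add: M_def T_def)
  qed
  then show "coeff P 0 = 0" and "coeff P 1 = coeff P 2"
    using sum0 by (simp_all add: \<alpha>_def \<beta>_def \<gamma>_def)
qed

theorem theorem5p2:
  fixes P :: "complex poly" and c :: complex and p :: "nat \<Rightarrow> complex poly"
  assumes "P \<noteq> 0"
    and "p 0 = [:0, 1:]"
    and "formally_solves P (shifted_series c p)"
  shows "coeff P 0 = 0 \<and> coeff P 1 = coeff P 2 \<and> degree P \<ge> 2 \<and>
    (\<forall>c' :: complex. \<forall>p' :: nat \<Rightarrow> complex poly.
       p' 0 = [:0, 1:] \<longrightarrow> formally_solves P (shifted_series c' p') \<longrightarrow>
       (\<forall>k. p' k = p k))"
proof -
  have sol: "formally_solves P (Abs_fps p)"
    using assms(3) by (rule formally_solves_unshifted)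
  have c0: "coeff P 0 = 0" and c12: "coeff P 1 = coeff P 2"
    using low_coefficients[OF sol] assms(2) by simp_all
  have "degree P \<ge> 2"
  proof (rule ccontr)
    assume "\<not> 2 \<le> degree P"
    then have high: "coeff P n = 0" if "n \<ge> 2" for n
      using that by (intro coeff_eq_0) simp
    have "coeff P n = 0" for n
      using high[of n] high[of 2] c0 c12 by (cases "n = 0 \<or> n = 1") auto
    then show False
      using \<open>P \<noteq> 0\<close> by (simp add: poly_eq_iff)
  qed
  moreover have "p' k = p k"
    if "p' 0 = [:0, 1:]" and "formally_solves P (shifted_series c' p')" for c' p' k
  proof -
    have "Abs_fps p' = Abs_fps p"
      using formally_solves_unshifted[OF that(2)] sol that(1) assms(2)
      by (intro formal_solution_unique) simp_all
    then show ?thesis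
      by (metis fps_nth_Abs_fps)
  qed
  ultimately show ?thesis
    using c0 c12 by blast
qed

end
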